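(* Let $k\ge 2$ and let $\tau_k$ be a task with $k-1$ higher-priority tasks $\tau_1,\dots,\tau_{k-1}$. Suppose a $k$-point effective schedulability test for $\tau_k$ under a given fixed-priority scheduling algorithm is given, with points $0<t_1\le t_2\le\cdots\le t_k$ and parameters $C_k>0$, $0<U_i\le 1$, $\alpha_i$, $\beta_i$ ($1\le i\le k-1$), and suppose that $\alpha,\beta$ are real numbers with $0<\alpha_i\le\alpha$ and $0<\beta_i\le\beta$ for all $i=1,\dots,k-1$. Then $\tau_k$ is schedulable by the scheduling algorithm if $$\frac{C_k}{t_k}+\sum_{i=1}^{k-1}U_i\le\begin{cases}1, & \text{if }(\alpha+\beta)^{\frac1k}<1,\\[4pt] (k-1)\dfrac{(1+\frac{\beta}{\alpha})^{\frac{1}{k-1}}-1}{\beta}, & \text{if }(\alpha+\beta)^{\frac1k}<\alpha,\\[8pt] \dfrac{(k-1)\left((\alpha+\beta)^{\frac1k}-1\right)+\left((\alpha+\beta)^{\frac1k}-\alpha\right)}{\beta}, & \text{otherwise.}\end{cases}$$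
   Context: A $k$-point effective schedulability test is a sufficient schedulability test for $\tau_k$ under a fixed-priority scheduling policy that, for given $0<t_1\le t_2\le\cdots\le t_k$, verifies the existence of an index $j\in\{1,\dots,k\}$ such that $$C_k+\sum_{i=1}^{k-1}\alpha_i t_iU_i+\sum_{i=1}^{j-1}\beta_i t_iU_i\le t_j,$$ where $C_k>0$, $\alpha_i>0$, $U_i>0$, $\beta_i>0$ are constants depending on the task model and on task $\tau_i$. "Sufficient" means: if such an index $j$ exists, then $\tau_k$ is schedulable (all its jobs meet their deadlines) under the policy. It is assumed throughout that $0<U_i\le 1$. *)

theory Defs
  imports Complex_Main
begin

text \<open>
  Effective schedulability tests are used for many task models (sporadic, arbitrary-deadline,
  self-suspending, parallel) on one or several processors. So a task model is given here by the
  job sequences it can release, and a scheduling algorithm by the schedules it can produce for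
  such a sequence.
\<close>

record ('t, 'j) job_sequence =
  jobs :: "'j set"
  task_of :: "'j \<Rightarrow> 't"
  arrival :: "'j \<Rightarrow> real"
  cost :: "'j \<Rightarrow> real"
  abs_deadline :: "'j \<Rightarrow> real"

text \<open>
  \<open>service S x t\<close> is the cumulative amount of execution that job \<open>x\<close> has received by time \<open>t\<close>.
  \<open>preferred S t x y\<close> means that at time \<open>t\<close> a processor for which both \<open>x\<close> and \<open>y\<close> contend is
  given to \<open>x\<close>. Which jobs contend at which times (preemptive or not, suspended or not, on which
  processors) is left to the task model and the platform.
\<close>

record 'j schedule =
  service :: "'j \<Rightarrow> real \<Rightarrow> real"
  preferred :: "real \<Rightarrow> 'j \<Rightarrow> 'j \<Rightarrow> bool"

definition completed_by :: "('t, 'j) job_sequence \<Rightarrow> 'j schedule \<Rightarrow> 'j \<Rightarrow> real \<Rightarrow> bool" where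
  "completed_by I S x t \<longleftrightarrow> cost I x \<le> service S x t"

definition pending :: "('t, 'j) job_sequence \<Rightarrow> 'j schedule \<Rightarrow> 'j \<Rightarrow> real \<Rightarrow> bool" where
  "pending I S x t \<longleftrightarrow> x \<in> jobs I \<and> arrival I x \<le> t \<and> \<not> completed_by I S x t"

definition valid_schedule :: "('t, 'j) job_sequence \<Rightarrow> 'j schedule \<Rightarrow> bool" where
  "valid_schedule I S \<longleftrightarrow>
     (\<forall>x\<in>jobs I. mono (service S x) \<and> (\<forall>t\<le>arrival I x. service S x t = 0)) \<and>
     (\<forall>t x y. preferred S t x y \<longrightarrow> pending I S x t \<and> pending I S y t)"

definition task_model :: "'t set \<Rightarrow> ('t, 'j) job_sequence set \<Rightarrow> bool" where
  "task_model T M \<longleftrightarrow>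
     (\<forall>I\<in>M. \<forall>x\<in>jobs I. task_of I x \<in> T \<and> 0 < cost I x \<and> arrival I x \<le> abs_deadline I x)"

text \<open>
  \<open>hp \<sigma> \<tau>\<close> means that \<open>\<sigma>\<close> has higher priority than \<open>\<tau>\<close>. It relates tasks, not jobs, and does
  not depend on time, which is what makes the priorities fixed.
\<close>

definition fixed_priority_algorithm ::
  "'t set \<Rightarrow> ('t \<Rightarrow> 't \<Rightarrow> bool) \<Rightarrow> ('t, 'j) job_sequence set
     \<Rightarrow> (('t, 'j) job_sequence \<Rightarrow> 'j schedule set) \<Rightarrow> bool" where
  "fixed_priority_algorithm T hp M alg \<longleftrightarrow>
     irreflp_on T hp \<and> transp_on T hp \<and> totalp_on T hp \<and>
     (\<forall>I\<in>M. \<forall>S\<in>alg I. valid_schedule I S \<and>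
        (\<forall>t x y. preferred S t x y \<longrightarrow> \<not> hp (task_of I y) (task_of I x)))"

definition schedulable ::
  "('t, 'j) job_sequence set \<Rightarrow> (('t, 'j) job_sequence \<Rightarrow> 'j schedule set) \<Rightarrow> 't \<Rightarrow> bool" where
  "schedulable M alg \<sigma> \<longleftrightarrow>
     (\<forall>I\<in>M. \<forall>S\<in>alg I. \<forall>x\<in>jobs I.
        task_of I x = \<sigma> \<longrightarrow> completed_by I S x (abs_deadline I x))"

definition k_point_condition ::
  "nat \<Rightarrow> real \<Rightarrow> (nat \<Rightarrow> real) \<Rightarrow> (nat \<Rightarrow> real) \<Rightarrow> (nat \<Rightarrow> real) \<Rightarrow> (nat \<Rightarrow> real) \<Rightarrow> bool" where
  "k_point_condition k C t U a b \<longleftrightarrow>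
     (\<exists>j\<in>{1..k}. C + (\<Sum>i=1..k-1. a i * t i * U i) + (\<Sum>i=1..j-1. b i * t i * U i) \<le> t j)"

text \<open>
  The argument \<open>\<sigma>\<close> is the task under analysis, \<open>C\<close> is its constant \<open>C\<^sub>k\<close>, and \<open>a i\<close> and \<open>b i\<close>
  are the coefficients \<open>\<alpha>\<^sub>i\<close> and \<open>\<beta>\<^sub>i\<close>.
\<close>

definition k_point_effective_test ::
  "('t, 'j) job_sequence set \<Rightarrow> (('t, 'j) job_sequence \<Rightarrow> 'j schedule set) \<Rightarrow> 't
     \<Rightarrow> nat \<Rightarrow> real \<Rightarrow> (nat \<Rightarrow> real) \<Rightarrow> (nat \<Rightarrow> real) \<Rightarrow> (nat \<Rightarrow> real) \<Rightarrow> (nat \<Rightarrow> real) \<Rightarrow> bool" where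
  "k_point_effective_test M alg \<sigma> k C t U a b \<longleftrightarrow>
     0 < t 1 \<and> mono_on {1..k} t \<and> 0 < C \<and>
     (\<forall>i\<in>{1..k-1}. 0 < a i \<and> 0 < U i \<and> 0 < b i) \<and>
     (k_point_condition k C t U a b \<longrightarrow> schedulable M alg \<sigma>)"

end

theory Submission
  imports Defs
begin

text \<open>
  If the test fails at every \<open>j\<close>, then its left-hand sides \<open>s j\<close>, with \<open>\<alpha>\<close> and \<open>\<beta>\<close> in place of
  \<open>\<alpha>\<^sub>i\<close> and \<open>\<beta>\<^sub>i\<close>, satisfy \<open>t j < s j\<close> and \<open>s (j + 1) - s j = \<beta> t j U j\<close>, and
  \<open>\<beta> C = (\<alpha> + \<beta>) s 1 - \<alpha> s k\<close>. Replacing \<open>t j\<close> by \<open>s j\<close> in the denominators therefore bounds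
  \<open>\<beta> (C / t k + \<Sum> U)\<close> strictly from below by
  \<open>(\<alpha> + \<beta>) / z - \<alpha> + \<Sum> (s (j + 1) / s j - 1)\<close>, where \<open>z = s k / s 1\<close>. The ratios multiply to \<open>z\<close>,
  so the tangent inequality \<open>x / c \<ge> 1 + ln (x / c)\<close> bounds their sum in terms of \<open>z\<close>. The optimal
  \<open>c\<close> is the \<open>k\<close>-th root of \<open>\<alpha> + \<beta>\<close>, attained at \<open>z = c ^ (k - 1)\<close>, unless this \<open>z\<close> exceeds the
  range \<open>z < 1 + \<beta> / \<alpha>\<close> forced by \<open>C > 0\<close>; then the boundary value of \<open>z\<close> is the worst one. If
  \<open>\<alpha> + \<beta> < 1\<close>, the test at \<open>j = k\<close> succeeds directly.
\<close>

lemma one_plus_ln_le: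
  fixes x :: real
  assumes "0 < x"
  shows "1 + ln x \<le> x"
  using ln_le_minus_one[OF assms] by simp

text \<open>Each ratio \<open>r\<close> is at least \<open>c * (1 + ln r - ln c)\<close> by the
  tangent inequality, and the logarithms telescope. Equality needs all ratios equal to
  \<open>c\<close>.\<close>

lemma sum_consecutive_ratios_ge:
  fixes s :: "nat \<Rightarrow> real"
  assumes "0 < c" and "\<And>j. j \<in> {1..Suc n} \<Longrightarrow> 0 < s j"
  shows "c * (real n + ln (s (Suc n) / s 1) - real n * ln c) \<le> (\<Sum>i=1..n. s (Suc i) / s i)"
  using assms(2)
proof (induction n)
  case 0
  then show ?case by simp
next
  case (Suc n)
  have pos: "0 < s 1" "0 < s (Suc n)" "0 < s (Suc (Suc n))"
    using Suc.prems by auto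
  define r where "r = s (Suc (Suc n)) / s (Suc n)"
  have r: "0 < r" using pos by (simp add: r_def)
  have "1 + ln (r / c) \<le> r / c" using r \<open>0 < c\<close> by (intro one_plus_ln_le) simp
  then have "c * (1 + ln r - ln c) \<le> r"
    using r \<open>0 < c\<close> by (simp add: ln_div field_simps)
  moreover have "ln (s (Suc (Suc n)) / s 1) = ln (s (Suc n) / s 1) + ln r"
    using pos by (simp add: r_def ln_div)
  moreover have "c * (real n + ln (s (Suc n) / s 1) - real n * ln c) \<le> (\<Sum>i=1..n. s (Suc i) / s i)"
    by (rule Suc.IH) (use Suc.prems in auto)
  ultimately show ?case by (simp add: r_def[symmetric] algebra_simps)
qed

text \<open>The parameter \<open>c\<close> is chosen only after \<open>z\<close>, so a single
  \<open>z\<close> serves both the interior and the boundary optimum.\<close>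

lemma utilization_of_failing_test_gt:
  fixes t U :: "nat \<Rightarrow> real" and C \<alpha> \<beta> :: real
  assumes "0 < C" "0 < \<alpha>" "0 < \<beta>"
    and t: "\<And>j. j \<in> {1..Suc n} \<Longrightarrow> 0 < t j"
    and U: "\<And>i. i \<in> {1..n} \<Longrightarrow> 0 < U i"
    and fails: "\<And>j. j \<in> {1..Suc n} \<Longrightarrow>
      t j < C + \<alpha> * (\<Sum>i=1..n. t i * U i) + \<beta> * (\<Sum>i=1..j-1. t i * U i)"
  obtains z where "0 < z" "z < 1 + \<beta> / \<alpha>"
    "\<And>c. 0 < c \<Longrightarrow> (\<alpha> + \<beta>) / z - \<alpha> - real n + c * (real n + ln z - real n * ln c)
       < \<beta> * (C / t (Suc n) + (\<Sum>i=1..n. U i))"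
proof -
  define s where "s j = C + \<alpha> * (\<Sum>i=1..n. t i * U i) + \<beta> * (\<Sum>i=1..j-1. t i * U i)" for j
  define z where "z = s (Suc n) / s 1"
  have ts: "t j < s j" if "j \<in> {1..Suc n}" for j
    using fails[OF that] by (simp add: s_def)
  have s: "0 < s j" if "j \<in> {1..Suc n}" for j
    using ts[OF that] t[OF that] by simp
  have s1: "0 < s 1" and sn: "0 < s (Suc n)" using s by auto
  \<comment> \<open>The case split excludes \<open>i = 0\<close>, where truncated subtraction would
    make both sums in \<open>s\<close> empty.\<close>
  have step: "\<beta> * (t i * U i) = s (Suc i) - s i" if "i \<in> {1..n}" for i
    using that by (cases i) (auto simp: s_def algebra_simps)
  \<comment> \<open>The difference \<open>s (Suc n) - s 1\<close> is \<open>\<beta>\<close> times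
    the full sum, which lets the \<open>\<alpha>\<close>-sum inside \<open>s 1\<close> be
    eliminated.\<close>
  have "\<beta> * s 1 = \<beta> * C + \<alpha> * (s (Suc n) - s 1)"
    by (simp add: s_def algebra_simps)
  then have C: "\<beta> * C = (\<alpha> + \<beta>) * s 1 - \<alpha> * s (Suc n)"
    by (simp add: algebra_simps)
  have U_ge: "s (Suc i) / s i - 1 \<le> \<beta> * U i" if i: "i \<in> {1..n}" for i
  proof -
    have "t i \<le> s i" "0 < s i" using ts[of i] s[of i] i by auto
    moreover have "t i * (\<beta> * U i) \<le> s i * (\<beta> * U i)"
      using \<open>t i \<le> s i\<close> U[OF i] \<open>0 < \<beta>\<close> by (intro mult_right_mono) auto
    ultimately show ?thesis using step[OF i] by (simp add: field_simps)
  qed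
  have "(\<Sum>i=1..n. s (Suc i) / s i) - real n = (\<Sum>i=1..n. s (Suc i) / s i - 1)"
    by (simp add: sum_subtractf)
  also have "\<dots> \<le> (\<Sum>i=1..n. \<beta> * U i)" using U_ge by (rule sum_mono)
  finally have sum_U: "(\<Sum>i=1..n. s (Suc i) / s i) - real n \<le> \<beta> * (\<Sum>i=1..n. U i)"
    by (simp add: sum_distrib_left)
  have "(\<alpha> + \<beta>) / z - \<alpha> = \<beta> * C / s (Suc n)"
    unfolding C z_def using s1 sn by (simp add: field_simps)
  \<comment> \<open>This is the source of the strict inequality; the bound on the sum of the
    \<open>U i\<close> is only weak.\<close>
  also have "\<dots> < \<beta> * C / t (Suc n)"
    using ts[of "Suc n"] t[of "Suc n"] \<open>0 < C\<close> \<open>0 < \<beta>\<close> by (intro divide_strict_left_mono) auto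
  finally have C_gt: "(\<alpha> + \<beta>) / z - \<alpha> < \<beta> * (C / t (Suc n))" by simp
  show thesis
  proof
    show "0 < z" using s1 sn by (simp add: z_def)
    have "0 < (\<alpha> + \<beta>) * s 1 - \<alpha> * s (Suc n)"
      using C mult_pos_pos[OF \<open>0 < \<beta>\<close> \<open>0 < C\<close>] by simp
    then show "z < 1 + \<beta> / \<alpha>"
      using s1 \<open>0 < \<alpha>\<close> by (simp add: z_def field_simps)
    fix c :: real
    assume "0 < c"
    from sum_consecutive_ratios_ge[OF this, of n s] s
    have "c * (real n + ln z - real n * ln c) \<le> (\<Sum>i=1..n. s (Suc i) / s i)"
      by (simp add: z_def)
    with sum_U C_gt
    show "(\<alpha> + \<beta>) / z - \<alpha> - real n + c * (real n + ln z - real n * ln c)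
      < \<beta> * (C / t (Suc n) + (\<Sum>i=1..n. U i))"
      by (simp add: distrib_left)
  qed
qed

text \<open>For \<open>c = m\<close>, the tangent inequality at
  \<open>(\<alpha> + \<beta>) / (z * m)\<close> minimises over all \<open>z > 0\<close>; equality
  holds at \<open>z = m ^ n\<close>.\<close>

lemma interior_optimum_le:
  fixes z \<alpha> \<beta> :: real and n :: nat
  assumes "0 < z" "0 < \<alpha> + \<beta>"
  defines "m \<equiv> (\<alpha> + \<beta>) powr (1 / real (Suc n))"
  shows "real (Suc n) * m \<le> (\<alpha> + \<beta>) / z + m * (real n + ln z - real n * ln m)"
proof -
  have m: "0 < m" using assms by (simp add: m_def)
  have ln_m: "real (Suc n) * ln m = ln (\<alpha> + \<beta>)"
    using assms by (simp add: m_def ln_powr)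
  have "1 + ln ((\<alpha> + \<beta>) / z / m) \<le> (\<alpha> + \<beta>) / z / m"
    using assms m by (intro one_plus_ln_le) simp
  then have "1 + (ln (\<alpha> + \<beta>) - ln z - ln m) \<le> (\<alpha> + \<beta>) / z / m"
    using assms(1,2) m by (simp add: ln_div ln_mult)
  then have "1 + (real n * ln m - ln z) \<le> (\<alpha> + \<beta>) / z / m"
    by (simp add: ln_m[symmetric] algebra_simps)
  then have "m * (1 + (real n * ln m - ln z)) \<le> (\<alpha> + \<beta>) / z"
    using m by (simp only: pos_le_divide_eq mult.commute)
  then show ?thesis by (simp add: algebra_simps)
qed

text \<open>Equality holds at the boundary \<open>z = 1 + \<beta> / \<alpha> = y ^ n\<close>. Moving
  inward by a factor \<open>w \<ge> 1\<close> changes the right side by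
  \<open>\<alpha> * (w - 1) - y * ln w\<close>, which is nonnegative since
  \<open>y \<le> \<alpha>\<close>.\<close>

lemma boundary_optimum_le:
  fixes z \<alpha> \<beta> :: real and n :: nat
  assumes "0 < n" "0 < z" "z \<le> 1 + \<beta> / \<alpha>" "0 < \<alpha>" "0 < \<beta>"
    and small: "(\<alpha> + \<beta>) powr (1 / real (Suc n)) < \<alpha>"
  defines "y \<equiv> (1 + \<beta> / \<alpha>) powr (1 / real n)"
  shows "real n * y + \<alpha> \<le> (\<alpha> + \<beta>) / z + y * (real n + ln z - real n * ln y)"
proof -
  define w where "w = (1 + \<beta> / \<alpha>) / z"
  have b: "0 < 1 + \<beta> / \<alpha>" using assms by (simp add: add_pos_pos)
  have y: "0 < y" using b by (simp add: y_def)
  have ln_y: "real n * ln y = ln (1 + \<beta> / \<alpha>)"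
    using b \<open>0 < n\<close> by (simp add: y_def ln_powr)
  have w: "1 \<le> w" using assms by (simp add: w_def)
  have ln_w: "ln w = real n * ln y - ln z"
    using b \<open>0 < z\<close> by (simp add: w_def ln_div ln_y)
  have w_eq: "(\<alpha> + \<beta>) / z = \<alpha> * w"
    using assms by (simp add: w_def field_simps)
  \<comment> \<open>The hypothesis \<open>small\<close> says
    \<open>\<alpha> + \<beta> < \<alpha> ^ (n + 1)\<close>; dividing by \<open>\<alpha>\<close>
    gives \<open>y ^ n < \<alpha> ^ n\<close>.\<close>
  have "ln ((\<alpha> + \<beta>) powr (1 / real (Suc n))) < ln \<alpha>"
    using small assms by (subst ln_less_cancel_iff) auto
  then have "ln (\<alpha> + \<beta>) < real (Suc n) * ln \<alpha>"
    using assms by (simp add: ln_powr field_simps)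
  moreover have "1 + \<beta> / \<alpha> = (\<alpha> + \<beta>) / \<alpha>" using assms by (simp add: field_simps)
  ultimately have "real n * ln y < real n * ln \<alpha>"
    using assms by (simp add: ln_y ln_div algebra_simps)
  then have "y \<le> \<alpha>" using \<open>0 < n\<close> y \<open>0 < \<alpha>\<close> by simp
  then have "y * ln w \<le> \<alpha> * ln w"
    using w by (intro mult_right_mono) auto
  moreover have "\<alpha> * (1 + ln w) \<le> \<alpha> * w"
    using w \<open>0 < \<alpha>\<close> one_plus_ln_le[of w] by simp
  ultimately show ?thesis by (simp add: w_eq ln_w algebra_simps)
qed

lemma k_point_condition_if_utilization_le:
  fixes t U a b :: "nat \<Rightarrow> real" and C \<alpha> \<beta> :: real
  assumes "0 < n" "0 < C"
    and t: "0 < t 1" "mono_on {1..Suc n} t"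
    and U: "\<And>i. i \<in> {1..n} \<Longrightarrow> 0 < U i"
    and a: "\<And>i. i \<in> {1..n} \<Longrightarrow> 0 < a i \<and> a i \<le> \<alpha>"
    and b: "\<And>i. i \<in> {1..n} \<Longrightarrow> 0 < b i \<and> b i \<le> \<beta>"
    and le: "C / t (Suc n) + (\<Sum>i=1..n. U i) \<le>
      (if (\<alpha> + \<beta>) powr (1 / real (Suc n)) < 1 then 1
       else if (\<alpha> + \<beta>) powr (1 / real (Suc n)) < \<alpha> then
         real n * (((1 + \<beta> / \<alpha>) powr (1 / real n) - 1) / \<beta>)
       else
         (real n * ((\<alpha> + \<beta>) powr (1 / real (Suc n)) - 1)
           + ((\<alpha> + \<beta>) powr (1 / real (Suc n)) - \<alpha>)) / \<beta>)"
      (is "?L \<le> _")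
  shows "k_point_condition (Suc n) C t U a b"
proof (rule ccontr)
  assume neg: "\<not> ?thesis"
  have \<alpha>: "0 < \<alpha>" using a[of 1] \<open>0 < n\<close> by simp
  have \<beta>: "0 < \<beta>" using b[of 1] \<open>0 < n\<close> by simp
  have t_pos: "0 < t j" if "j \<in> {1..Suc n}" for j
    using t that mono_onD[OF t(2), of 1 j] by auto
  \<comment> \<open>Raising the coefficients to their common bounds only enlarges the left side of
    the test, so the failure persists.\<close>
  have fails: "t j < C + \<alpha> * (\<Sum>i=1..n. t i * U i) + \<beta> * (\<Sum>i=1..j-1. t i * U i)"
    if j: "j \<in> {1..Suc n}" for j
  proof -
    have tU: "0 \<le> t i * U i" if "i \<in> {1..n}" for i
      using that U[of i] t_pos[of i] by simp
    have "(\<Sum>i=1..n. a i * t i * U i) \<le> (\<Sum>i=1..n. \<alpha> * (t i * U i))"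
      using a tU by (intro sum_mono) (simp add: mult.assoc mult_right_mono)
    moreover have "(\<Sum>i=1..j-1. b i * t i * U i) \<le> (\<Sum>i=1..j-1. \<beta> * (t i * U i))"
    proof (rule sum_mono)
      fix i assume "i \<in> {1..j-1}"
      then have "i \<in> {1..n}" using j by auto
      then show "b i * t i * U i \<le> \<beta> * (t i * U i)"
        using b tU by (simp add: mult.assoc mult_right_mono)
    qed
    moreover have "t j < C + (\<Sum>i=1..n. a i * t i * U i) + (\<Sum>i=1..j-1. b i * t i * U i)"
      using neg j by (force simp: k_point_condition_def not_le)
    ultimately show ?thesis by (simp add: sum_distrib_left)
  qed
  obtain z where z: "0 < z" "z < 1 + \<beta> / \<alpha>"
    and L: "\<And>c. 0 < c \<Longrightarrow> (\<alpha> + \<beta>) / z - \<alpha> - real n + c * (real n + ln z - real n * ln c) < \<beta> * ?L"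
    using utilization_of_failing_test_gt[OF \<open>0 < C\<close> \<alpha> \<beta> t_pos U fails] by blast
  let ?m = "(\<alpha> + \<beta>) powr (1 / real (Suc n))"
  let ?y = "(1 + \<beta> / \<alpha>) powr (1 / real n)"
  consider "?m < 1" | "\<not> ?m < 1" "?m < \<alpha>" | "\<not> ?m < 1" "\<not> ?m < \<alpha>" by blast
  then show False
  proof cases
    case 1
    have "\<alpha> + \<beta> < 1"
    proof (rule ccontr)
      assume "\<not> \<alpha> + \<beta> < 1"
      then have "1 \<le> ?m" by (intro ge_one_powr_ge_zero) auto
      with 1 show False by simp
    qed
    \<comment> \<open>At the last point both sums have full range. The bounds
      \<open>t i \<le> t (Suc n)\<close> and \<open>\<alpha> + \<beta> < 1\<close> reduce that test
      to the assumed utilization bound times \<open>t (Suc n)\<close>.\<close>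
    have tn: "0 < t (Suc n)" using t_pos by simp
    have "(\<Sum>i=1..n. t i * U i) \<le> (\<Sum>i=1..n. t (Suc n) * U i)"
      using U mono_onD[OF t(2), of _ "Suc n"] by (intro sum_mono mult_right_mono) (auto simp: less_imp_le)
    also have "\<dots> = t (Suc n) * (\<Sum>i=1..n. U i)" by (simp add: sum_distrib_left)
    finally have "(\<Sum>i=1..n. t i * U i) \<le> t (Suc n) * (\<Sum>i=1..n. U i)" .
    moreover have "0 \<le> (\<Sum>i=1..n. t i * U i)"
      using U t_pos by (intro sum_nonneg) (simp add: less_imp_le)
    then have "(\<alpha> + \<beta>) * (\<Sum>i=1..n. t i * U i) \<le> (\<Sum>i=1..n. t i * U i)"
      using \<open>\<alpha> + \<beta> < 1\<close> by (intro mult_left_le_one_le) (use \<alpha> \<beta> in auto)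
    moreover have "C + t (Suc n) * (\<Sum>i=1..n. U i) \<le> t (Suc n)"
      using le 1 tn by (simp add: field_simps)
    ultimately show False
      using fails[of "Suc n"] by (simp add: distrib_right)
  next
    case 2
    have "0 < 1 + \<beta> / \<alpha>" using \<alpha> \<beta> by (simp add: add_pos_pos)
    then have "0 < ?y" by simp
    \<comment> \<open>With \<open>c = ?y\<close>, the \<open>\<alpha>\<close> in the boundary value
      cancels the \<open>- \<alpha>\<close> in \<open>L\<close>.\<close>
    from L[OF this] boundary_optimum_le[OF \<open>0 < n\<close> z(1) less_imp_le[OF z(2)] \<alpha> \<beta> 2(2)]
    have "real n * (?y - 1) < \<beta> * ?L" by (simp add: right_diff_distrib)
    moreover have "?L \<le> real n * (?y - 1) / \<beta>" using le 2 by simp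
    ultimately show False using \<beta> by (simp add: le_divide_eq mult.commute)
  next
    case 3
    have "0 < ?m" using \<alpha> \<beta> by simp
    \<comment> \<open>With \<open>c = ?m\<close>, the value \<open>(n + 1) * ?m\<close> less
      \<open>\<alpha> + n\<close> regroups into the third bound.\<close>
    from L[OF this] interior_optimum_le[OF z(1), of \<alpha> \<beta> n] \<alpha> \<beta>
    have "real n * (?m - 1) + (?m - \<alpha>) < \<beta> * ?L" by (simp add: algebra_simps)
    moreover have "?L \<le> (real n * (?m - 1) + (?m - \<alpha>)) / \<beta>" using le 3 by simp
    ultimately show False using \<beta> by (simp add: le_divide_eq mult.commute)
  qed
qed

theorem lemma2:
  fixes T :: "'t set"
    and hp :: "'t \<Rightarrow> 't \<Rightarrow> bool"
    and M :: "('t, 'j) job_sequence set"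
    and alg :: "('t, 'j) job_sequence \<Rightarrow> 'j schedule set"
    and \<tau> :: "nat \<Rightarrow> 't"
    and k :: nat
    and C :: real
    and t U a b :: "nat \<Rightarrow> real"
    and \<alpha> \<beta> :: real
  assumes "k \<ge> 2"
    and "task_model T M"
    and "fixed_priority_algorithm T hp M alg"
    and "\<tau> k \<in> T"
    and "bij_betw \<tau> {1..k-1} {\<sigma> \<in> T. hp \<sigma> (\<tau> k)}"
    and "k_point_effective_test M alg (\<tau> k) k C t U a b"
    and "\<And>i. i \<in> {1..k-1} \<Longrightarrow> 0 < U i \<and> U i \<le> 1"
    and "\<And>i. i \<in> {1..k-1} \<Longrightarrow> 0 < a i \<and> a i \<le> \<alpha>"
    and "\<And>i. i \<in> {1..k-1} \<Longrightarrow> 0 < b i \<and> b i \<le> \<beta>"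
    and "C / t k + (\<Sum>i=1..k-1. U i) \<le>
      (if (\<alpha> + \<beta>) powr (1 / real k) < 1 then 1
       else if (\<alpha> + \<beta>) powr (1 / real k) < \<alpha> then
         (real k - 1) * (((1 + \<beta> / \<alpha>) powr (1 / (real k - 1)) - 1) / \<beta>)
       else
         ((real k - 1) * ((\<alpha> + \<beta>) powr (1 / real k) - 1)
           + ((\<alpha> + \<beta>) powr (1 / real k) - \<alpha>)) / \<beta>)"
  shows "schedulable M alg (\<tau> k)"
proof -
  define n where "n = k - 1"
  have k: "k = Suc n" "0 < n" using \<open>k \<ge> 2\<close> by (auto simp: n_def)
  have test: "0 < t 1" "mono_on {1..k} t" "0 < C"
      "k_point_condition k C t U a b \<Longrightarrow> schedulable M alg (\<tau> k)"
    using assms(6) by (auto simp: k_point_effective_test_def)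
  have pred: "k - 1 = n" "real k - 1 = real n" using k by simp_all
  have "k_point_condition (Suc n) C t U a b"
    by (rule k_point_condition_if_utilization_le[where \<alpha> = \<alpha> and \<beta> = \<beta> and t = t and U = U and C = C and n = n,
          OF _ _ _ _ _ _ _ assms(10)[unfolded pred, unfolded k(1)]])
      (use assms(7-9) test k in simp_all)
  with test k show ?thesis by simp
qed

end
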